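(* Let $p\in[1,\infty)$ and let $n\ge 2$ be an integer. $L_p$-norm spherical copulas in dimension $n$ are unique if they exist. That is, there is at most one probability distribution on $\mathbb{R}^n$ that is a positive $L_p$-norm spherical copula, and there is at most one probability distribution on $\mathbb{R}^n$ that is a circular $L_p$-norm spherical copula.
   Context: For $p\in[1,\infty)$ and $x\in\mathbb{R}^n$ put $\|x\|_p=(\sum_{i=1}^n|x_i|^p)^{1/p}$. If a random vector $Z$ in $\mathbb{R}^n$ has a density of the form $g(\|x\|_p)$, then $\|Z\|_p$ and $Z/\|Z\|_p$ are independent and the law of $Z/\|Z\|_p$ does not depend on $g$ (one may take, for instance, $Z$ uniformly distributed on the unit ball $\{\|x\|_p<1\}$); this law is called the $L_p$-uniform distribution on the sphere, and $U_n$ denotes a random vector with this law. Let $U_n^+$ be the vector of componentwise absolute values of $U_n$. A random vector has an $L_p$-norm spherical distribution on $\mathbb{R}^n$ if it has the same law as $R\cdot U_n$, where $R\ge 0$ is a real random variable independent of $U_n$. It has an $L_p$-norm spherical distribution on $\mathbb{R}_+^n=[0,\infty)^n$ if it has the same law as $R\cdot U_n^+$, with $R\ge0$ a real random variable independent of $U_n^+$. A copula is a probability distribution on $[0,1]^n$ all of whose univariate marginals are uniform on $(0,1)$. A copula is called a positive $L_p$-norm spherical copula if it is an $L_p$-norm spherical distribution on $\mathbb{R}_+^n$. The distribution of a random vector $(X_1^\circ,\dots,X_n^\circ)$ with marginals uniform on $(0,1)$ is called a circular $L_p$-norm spherical copula if $(2X_1^\circ-1,\dots,2X_n^\circ-1)$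 has an $L_p$-norm spherical distribution on $\mathbb{R}^n$. *)

theory Defs
  imports "HOL-Probability.Probability"
begin

definition lp_norm :: "real \<Rightarrow> real ^ 'n \<Rightarrow> real" where
  "lp_norm p x = (\<Sum>i\<in>UNIV. \<bar>x $ i\<bar> powr p) powr (1 / p)"

definition componentwise_abs :: "real ^ 'n \<Rightarrow> real ^ 'n" where
  "componentwise_abs x = (\<chi> i. \<bar>x $ i\<bar>)"

(* The law of Z / ||Z||_p for Z uniform on the open unit p-ball; the normalisation sends
   the null event Z = 0 to 0. *)
definition lp_uniform :: "real \<Rightarrow> (real ^ 'n) measure" where
  "lp_uniform p =
     distr (uniform_measure lborel {x. lp_norm p x < 1}) borel (\<lambda>x. x /\<^sub>R lp_norm p x)"

definition lp_uniform_pos :: "real \<Rightarrow> (real ^ 'n) measure" where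
  "lp_uniform_pos p = distr (lp_uniform p) borel componentwise_abs"

(* M is the law of R *\<^sub>R U for a real R \<ge> 0 independent of a vector U with law S, where N is
   the law of R: independence says that (R, U) has law N \<Otimes>\<^sub>M S. The library's indep_var
   does not apply because it needs both variables to take values in the same type. *)
definition is_radial_mixture :: "(real ^ 'n) measure \<Rightarrow> (real ^ 'n) measure \<Rightarrow> bool" where
  "is_radial_mixture S M \<longleftrightarrow>
     (\<exists>N :: real measure.
        prob_space N \<and> sets N = sets borel \<and> (AE r in N. 0 \<le> r) \<and>
        M = distr (N \<Otimes>\<^sub>M S) borel (\<lambda>(r, u). r *\<^sub>R u))"

definition lp_spherical :: "real \<Rightarrow> (real ^ 'n) measure \<Rightarrow> bool" where
  "lp_spherical p M \<longleftrightarrow> is_radial_mixture (lp_uniform p) M"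

definition lp_spherical_pos :: "real \<Rightarrow> (real ^ 'n) measure \<Rightarrow> bool" where
  "lp_spherical_pos p M \<longleftrightarrow> is_radial_mixture (lp_uniform_pos p) M"

definition borel_prob :: "(real ^ 'n) measure \<Rightarrow> bool" where
  "borel_prob C \<longleftrightarrow> prob_space C \<and> sets C = sets borel"

definition uniform_marginals :: "(real ^ 'n) measure \<Rightarrow> bool" where
  "uniform_marginals C \<longleftrightarrow>
     (\<forall>i. distr C borel (\<lambda>x. x $ i) = uniform_measure lborel {0 <..< 1 :: real})"

definition copula :: "(real ^ 'n) measure \<Rightarrow> bool" where
  "copula C \<longleftrightarrow>
     borel_prob C \<and> (AE x in C. \<forall>i. x $ i \<in> {0..1}) \<and> uniform_marginals C"

definition positive_lp_copula :: "real \<Rightarrow> (real ^ 'n) measure \<Rightarrow> bool" where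
  "positive_lp_copula p C \<longleftrightarrow> copula C \<and> lp_spherical_pos p C"

definition circular_lp_copula :: "real \<Rightarrow> (real ^ 'n) measure \<Rightarrow> bool" where
  "circular_lp_copula p C \<longleftrightarrow>
     borel_prob C \<and> uniform_marginals C \<and>
     lp_spherical p (distr C borel (\<lambda>x. \<chi> i. 2 * x $ i - 1))"

end

theory Submission imports Defs
begin

text \<open>A coordinate of a radial mixture satisfies \<open>\<bar>X\<^sub>i\<bar> = R \<bar>U\<^sub>i\<bar>\<close> with independent factors,
  so \<open>E \<bar>X\<^sub>i\<bar>\<^sup>k = E R\<^sup>k E \<bar>U\<^sub>i\<bar>\<^sup>k\<close>. Since \<open>U\<^sub>i\<close> is not almost surely zero, the law of one bounded
  coordinate determines all moments of \<open>R\<close> and forces \<open>R\<close> to be essentially bounded; a bounded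
  random variable is determined by its moments.\<close>

section \<open>Bounded real distributions are determined by their moments\<close>

lemma (in finite_measure) integrable_power_of_bounded:
  fixes f :: "'a \<Rightarrow> real"
  assumes [measurable]: "f \<in> borel_measurable M" and "AE x in M. \<bar>f x\<bar> \<le> B"
  shows "integrable M (\<lambda>x. f x ^ k)"
proof (rule integrable_const_bound[of _ "B ^ k"])
  show "AE x in M. norm (f x ^ k) \<le> B ^ k"
    using assms(2) by eventually_elim (auto simp: power_abs intro!: power_mono)
qed simp

text \<open>Taylor expansion of the characteristic function: the essential bound \<open>B\<close>
  gives E|x|^n \<le> B^n, so the remainder is at most 2(|t|B)^n/n!, which tends to 0 for every
  \<open>t\<close>.\<close>

lemma (in real_distribution) char_moment_series:
  assumes bdd: "AE x in M. \<bar>x\<bar> \<le> B"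
  shows "(\<lambda>n. \<Sum>k\<le>n. ((\<i> * complex_of_real t) ^ k / fact k) * expectation (\<lambda>x. x ^ k))
           \<longlonglongrightarrow> char M t"
proof -
  have int: "integrable M (\<lambda>x. x ^ k)" "integrable M (\<lambda>x. \<bar>x\<bar> ^ k)" for k
    using bdd by (auto intro!: integrable_power_of_bounded)
  have le: "expectation (\<lambda>x. \<bar>x\<bar> ^ k) \<le> B ^ k" for k
  proof -
    have "expectation (\<lambda>x. \<bar>x\<bar> ^ k) \<le> expectation (\<lambda>x. B ^ k)"
    proof (rule integral_mono_AE)
      show "AE x in M. \<bar>x\<bar> ^ k \<le> B ^ k"
        using bdd by eventually_elim (auto intro!: power_mono)
    qed (use int in auto)
    then show ?thesis by (simp add: prob_space[simplified])
  qed
  have "(\<lambda>n. (\<Sum>k\<le>n. ((\<i> * complex_of_real t) ^ k / fact k) * expectation (\<lambda>x. x ^ k))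
            - char M t) \<longlonglongrightarrow> 0"
  proof (rule Lim_null_comparison)
    show "\<forall>\<^sub>F n in sequentially.
            cmod ((\<Sum>k\<le>n. ((\<i> * complex_of_real t) ^ k / fact k) * expectation (\<lambda>x. x ^ k))
              - char M t) \<le> 2 * ((\<bar>t\<bar> * B) ^ n / fact n)"
    proof (intro always_eventually allI)
      fix n
      have "cmod (char M t
              - (\<Sum>k\<le>n. ((\<i> * complex_of_real t) ^ k / fact k) * expectation (\<lambda>x. x ^ k)))
            \<le> (2 * \<bar>t\<bar> ^ n / fact n) * expectation (\<lambda>x. \<bar>x\<bar> ^ n)"
        \<comment> \<open>The sum keeps the term of order \<open>n\<close>, yet the error bound is
          also of order \<open>n\<close>; hence the factor 2.\<close>
        using char_approx1[of n t] int by simp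
      also have "\<dots> \<le> (2 * \<bar>t\<bar> ^ n / fact n) * B ^ n"
        by (intro mult_left_mono le) auto
      finally show "cmod ((\<Sum>k\<le>n. ((\<i> * complex_of_real t) ^ k / fact k)
              * expectation (\<lambda>x. x ^ k)) - char M t) \<le> 2 * ((\<bar>t\<bar> * B) ^ n / fact n)"
        by (simp add: norm_minus_commute power_mult_distrib)
    qed
    have "(\<lambda>n. 2 * ((\<bar>t\<bar> * B) ^ n / fact n)) \<longlonglongrightarrow> 2 * 0"
      by (intro tendsto_intros summable_LIMSEQ_zero)
        (use summable_exp[of "\<bar>t\<bar> * B"] in \<open>simp add: field_simps\<close>)
    then show "(\<lambda>n. 2 * ((\<bar>t\<bar> * B) ^ n / fact n)) \<longlonglongrightarrow> 0" by simp
  qed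
  then show ?thesis by (rule LIM_zero_cancel)
qed

text \<open>Equal moments make the two moment series agree term by term, so both characteristic
  functions are limits of one sequence, and Levy's uniqueness theorem identifies the laws.\<close>

lemma bounded_distribution_eq_of_moments:
  assumes "real_distribution M" "real_distribution N"
    and "AE x in M. \<bar>x\<bar> \<le> B" "AE x in N. \<bar>x\<bar> \<le> C"
    and moments: "\<And>k. (\<integral>x. x ^ k \<partial>M) = (\<integral>x. x ^ k \<partial>N)"
  shows "M = N"
proof (rule Levy_uniqueness)
  show "char M = char N"
  proof
    fix t
    show "char M t = char N t"
      using real_distribution.char_moment_series[OF assms(1,3), of t]
        real_distribution.char_moment_series[OF assms(2,4), of t]
      unfolding moments by (rule LIMSEQ_unique)
  qed
qed fact+

section \<open>Recovering the radial law from one coordinate\<close>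

lemma vec_nth_borel_measurable [measurable]: "(\<lambda>x::real ^ 'n. x $ i) \<in> borel_measurable borel"
  by (intro borel_measurable_continuous_onI continuous_intros)

text \<open>Some level 1/(n+1) is exceeded by |u_i| with positive probability. By Fubini, almost
  every \<open>r\<close> satisfies |r u_i| \<le> c for almost every \<open>u\<close>, and a
  \<open>u\<close> above that level forces |r| \<le> c(n+1). This supplies the boundedness required
  for moments to determine the radius.\<close>

lemma essentially_bounded_factor:
  fixes N :: "real measure" and S :: "(real ^ 'n) measure"
  assumes "prob_space N" "sets N = sets borel" "prob_space S" "sets S = sets borel"
    and nz: "\<not> (AE u in S. u $ i = 0)"
    and bdd: "AE x in distr (N \<Otimes>\<^sub>M S) borel (\<lambda>(r, u). r *\<^sub>R u). \<bar>x $ i\<bar> \<le> c"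
  obtains B where "AE r in N. \<bar>r\<bar> \<le> B"
proof -
  interpret N: prob_space N by fact
  interpret S: prob_space S by fact
  interpret P: pair_prob_space N S ..
  note [measurable_cong] = assms(2,4)
  \<comment> \<open>The event u_i = 0 is the countable intersection of the events |u_i| \<le>
    1/(n+1); if each of these held almost surely, so would it.\<close>
  have "\<exists>n::nat. \<not> (AE u in S. \<bar>u $ i\<bar> \<le> 1 / Suc n)"
  proof (rule ccontr)
    assume "\<not> ?thesis"
    then have "AE u in S. \<forall>n::nat. \<bar>u $ i\<bar> \<le> 1 / Suc n"
      by (simp add: AE_all_countable)
    then have "AE u in S. u $ i = 0"
    proof eventually_elim
      case (elim u)
      show ?case
      proof (rule ccontr)
        assume "u $ i \<noteq> 0"
        then obtain n where "inverse (Suc n) < \<bar>u $ i\<bar>"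
          using reals_Archimedean[of "\<bar>u $ i\<bar>"] by auto
        with elim[rule_format, of n] show False by (simp add: inverse_eq_divide)
      qed
    qed
    with nz show False ..
  qed
  then obtain n :: nat where n: "\<not> (AE u in S. \<bar>u $ i\<bar> \<le> 1 / Suc n)" ..
  have "AE z in N \<Otimes>\<^sub>M S. \<bar>(case z of (r, u) \<Rightarrow> r *\<^sub>R u) $ i\<bar> \<le> c"
    using bdd by (subst (asm) AE_distr_iff) auto
  then have "AE r in N. AE u in S. \<bar>r * u $ i\<bar> \<le> c"
    by (auto dest: P.AE_pair)
  then have "AE r in N. \<bar>r\<bar> \<le> c * Suc n"
  proof eventually_elim
    case (elim r)
    show ?case
    proof (rule ccontr)
      assume r: "\<not> ?thesis"
      \<comment> \<open>An \<open>r\<close> beyond \<open>c * Suc n\<close> would keep |u_i| almost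
        surely within the level that the choice of \<open>n\<close> rules out.\<close>
      from elim have "AE u in S. \<bar>u $ i\<bar> \<le> 1 / Suc n"
      proof eventually_elim
        case (elim u)
        show ?case
        proof (rule ccontr)
          assume "\<not> ?thesis"
          then have u: "1 < \<bar>u $ i\<bar> * Suc n" by (simp add: field_simps)
          have "c * Suc n < \<bar>r\<bar> * 1" using r by simp
          also have "\<dots> \<le> \<bar>r\<bar> * (\<bar>u $ i\<bar> * Suc n)" using u by (intro mult_left_mono) auto
          also have "\<dots> = \<bar>r * u $ i\<bar> * Suc n" by (simp add: abs_mult)
          also have "\<dots> \<le> c * Suc n" using elim by (intro mult_right_mono) auto
          finally show False by simp
        qed
      qed
      with n show False ..
    qed
  qed
  then show thesis by (rule that)
qed

text \<open>Independence factors the moment. Fubini applies because both factors are bounded, and a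
  nonnegative radius lets its absolute value be dropped, so odd moments of \<open>N\<close> are
  captured too.\<close>

lemma moments_of_radial_mixture:
  fixes N :: "real measure" and S :: "(real ^ 'n) measure"
  assumes "prob_space N" "sets N = sets borel" "prob_space S" "sets S = sets borel"
    and nonneg: "AE r in N. 0 \<le> r"
    and bdd: "AE r in N. \<bar>r\<bar> \<le> B" "AE u in S. \<bar>u $ i\<bar> \<le> b"
  shows "(\<integral>x. \<bar>x $ i\<bar> ^ k \<partial>distr (N \<Otimes>\<^sub>M S) borel (\<lambda>(r, u). r *\<^sub>R u))
           = (\<integral>r. r ^ k \<partial>N) * (\<integral>u. \<bar>u $ i\<bar> ^ k \<partial>S)"
proof -
  interpret N: prob_space N by fact
  interpret S: prob_space S by fact
  interpret P: pair_prob_space N S ..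
  note [measurable_cong] = assms(2,4)
  \<comment> \<open>The doubled absolute value fits \<open>integrable_power_of_bounded\<close>,
    applied to the function |r u_i|.\<close>
  have "AE z in N \<Otimes>\<^sub>M S. \<bar>\<bar>fst z * snd z $ i\<bar>\<bar> \<le> B * b"
  proof (rule P.AE_pair_measure)
    show "AE r in N. AE u in S. \<bar>\<bar>fst (r, u) * snd (r, u) $ i\<bar>\<bar> \<le> B * b"
      using bdd(1)
    proof eventually_elim
      case (elim r)
      show ?case using bdd(2)
        by eventually_elim (use elim in \<open>auto simp: abs_mult intro!: mult_mono\<close>)
    qed
  qed measurable
  then have int: "integrable (N \<Otimes>\<^sub>M S) (\<lambda>z. \<bar>fst z * snd z $ i\<bar> ^ k)"
    by (intro P.integrable_power_of_bounded) auto
  have "(\<integral>x. \<bar>x $ i\<bar> ^ k \<partial>distr (N \<Otimes>\<^sub>M S) borel (\<lambda>(r, u). r *\<^sub>R u))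
          = (\<integral>z. \<bar>fst z * snd z $ i\<bar> ^ k \<partial>(N \<Otimes>\<^sub>M S))"
    by (subst integral_distr) (auto simp: case_prod_beta)
  also have "\<dots> = (\<integral>r. (\<integral>u. \<bar>r * u $ i\<bar> ^ k \<partial>S) \<partial>N)"
    using P.integral_fst'[OF int] by simp
  also have "\<dots> = (\<integral>r. r ^ k * (\<integral>u. \<bar>u $ i\<bar> ^ k \<partial>S) \<partial>N)"
  proof (rule integral_cong_AE)
    show "AE r in N. (\<integral>u. \<bar>r * u $ i\<bar> ^ k \<partial>S) = r ^ k * (\<integral>u. \<bar>u $ i\<bar> ^ k \<partial>S)"
      using nonneg by eventually_elim (simp add: abs_mult power_mult_distrib)
  qed measurable
  finally show ?thesis by simp
qed

text \<open>The law of one coordinate fixes all moments of the radius, hence the radial law, which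
  together with \<open>S\<close> fixes the mixture. The bound is asked of \<open>M\<close> alone
  because it passes to \<open>M'\<close> through the common marginal.\<close>

lemma radial_mixture_eq_of_marginal:
  fixes S M M' :: "(real ^ 'n) measure"
  assumes S: "prob_space S" "sets S = sets borel"
    and S_bdd: "AE u in S. \<bar>u $ i\<bar> \<le> b" and nz: "\<not> (AE u in S. u $ i = 0)"
    and M: "is_radial_mixture S M" "is_radial_mixture S M'"
    and marginal: "distr M borel (\<lambda>x. x $ i) = distr M' borel (\<lambda>x. x $ i)"
    and M_bdd: "AE x in M. \<bar>x $ i\<bar> \<le> c"
  shows "M = M'"
proof -
  obtain N where N: "prob_space N" "sets N = sets borel" "AE r in N. 0 \<le> r"
    and M_eq: "M = distr (N \<Otimes>\<^sub>M S) borel (\<lambda>(r, u). r *\<^sub>R u)"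
    using M(1) unfolding is_radial_mixture_def by blast
  obtain N' where N': "prob_space N'" "sets N' = sets borel" "AE r in N'. 0 \<le> r"
    and M'_eq: "M' = distr (N' \<Otimes>\<^sub>M S) borel (\<lambda>(r, u). r *\<^sub>R u)"
    using M(2) unfolding is_radial_mixture_def by blast
  interpret S: prob_space S by fact
  have [measurable_cong]: "sets M = sets borel" "sets M' = sets borel"
    by (simp_all add: M_eq M'_eq)
  note [measurable_cong] = S(2)
  have "AE y in distr M borel (\<lambda>x. x $ i). \<bar>y\<bar> \<le> c"
    using M_bdd by (subst AE_distr_iff) auto
  then have M'_bdd: "AE x in M'. \<bar>x $ i\<bar> \<le> c"
    unfolding marginal by (subst (asm) AE_distr_iff) auto
  obtain B where B: "AE r in N. \<bar>r\<bar> \<le> B"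
    using essentially_bounded_factor[OF N(1,2) S nz M_bdd[unfolded M_eq]] .
  obtain B' where B': "AE r in N'. \<bar>r\<bar> \<le> B'"
    using essentially_bounded_factor[OF N'(1,2) S nz M'_bdd[unfolded M'_eq]] .
  have "N = N'"
  proof (rule bounded_distribution_eq_of_moments[OF _ _ B B'])
    fix k
    have "(\<integral>x. \<bar>x $ i\<bar> ^ k \<partial>M) = (\<integral>y. \<bar>y\<bar> ^ k \<partial>distr M borel (\<lambda>x. x $ i))"
      by (subst integral_distr) auto
    also have "\<dots> = (\<integral>x. \<bar>x $ i\<bar> ^ k \<partial>M')"
      unfolding marginal by (subst integral_distr) auto
    finally have eq: "(\<integral>r. r ^ k \<partial>N) * (\<integral>u. \<bar>u $ i\<bar> ^ k \<partial>S)
        = (\<integral>r. r ^ k \<partial>N') * (\<integral>u. \<bar>u $ i\<bar> ^ k \<partial>S)"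
      unfolding M_eq M'_eq moments_of_radial_mixture[OF N(1,2) S N(3) B S_bdd]
        moments_of_radial_mixture[OF N'(1,2) S N'(3) B' S_bdd] .
    have int: "integrable S (\<lambda>u. \<bar>u $ i\<bar> ^ k)"
      using S_bdd by (intro S.integrable_power_of_bounded) auto
    \<comment> \<open>This allows the common angular moment to be cancelled from
      \<open>eq\<close>.\<close>
    have "(\<integral>u. \<bar>u $ i\<bar> ^ k \<partial>S) \<noteq> 0"
    proof
      assume "(\<integral>u. \<bar>u $ i\<bar> ^ k \<partial>S) = 0"
      then have "AE u in S. \<bar>u $ i\<bar> ^ k = 0"
        by (subst (asm) integral_nonneg_eq_0_iff_AE[OF int]) auto
      then have "AE u in S. u $ i = 0" by eventually_elim auto
      with nz show False ..
    qed
    with eq show "(\<integral>r. r ^ k \<partial>N) = (\<integral>r. r ^ k \<partial>N')" by simp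
  qed (auto simp: real_distribution_def real_distribution_axioms_def N N')
  then show ?thesis by (simp add: M_eq M'_eq)
qed

section \<open>The L_p norm, its unit ball and the uniform law on the sphere\<close>

lemma abs_nth_le_lp_norm:
  assumes "0 < p"
  shows "\<bar>x $ i\<bar> \<le> lp_norm p x"
proof -
  have "\<bar>x $ i\<bar> = (\<bar>x $ i\<bar> powr p) powr (1 / p)"
    using assms by (simp add: powr_powr)
  also have "\<dots> \<le> lp_norm p x"
    unfolding lp_norm_def using assms
    by (intro powr_mono2 member_le_sum) auto
  finally show ?thesis .
qed

lemma continuous_on_lp_norm:
  assumes "0 < p"
  shows "continuous_on UNIV (lp_norm p)"
  unfolding lp_norm_def using assms
  by (intro continuous_on_powr' continuous_intros) (auto intro!: sum_nonneg)

lemma lp_norm_borel_measurable: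
  "0 < p \<Longrightarrow> lp_norm p \<in> borel_measurable borel"
  by (intro borel_measurable_continuous_onI continuous_on_lp_norm)

text \<open>These facts make the uniform law on the ball a genuine probability measure: the ball is
  open and contains 0, hence is not null, and it lies in the cube [-1,1]^n, hence has finite
  measure.\<close>

lemma emeasure_lp_ball:
  fixes p :: real
  assumes "0 < p"
  defines "A \<equiv> {x :: real ^ 'n. lp_norm p x < 1}"
  shows "emeasure lborel A \<noteq> 0" "emeasure lborel A < \<infinity>" "A \<in> sets borel"
proof -
  have "open A"
    unfolding A_def by (intro open_Collect_less continuous_on_lp_norm continuous_intros assms)
  then show "A \<in> sets borel" by simp
  have "0 \<in> A" using assms by (simp add: A_def lp_norm_def)
  then have "\<not> negligible A" using open_not_negligible[OF \<open>open A\<close>] by auto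
  then show "emeasure lborel A \<noteq> 0"
    using \<open>A \<in> sets borel\<close> by (auto simp: negligible_iff_null_sets null_sets_completion_iff null_sets_def)
  have "A \<subseteq> cbox (\<chi> i. -1) (\<chi> i. 1)"
  proof
    fix x assume "x \<in> A"
    then have "\<bar>x $ i\<bar> < 1" for i
      using abs_nth_le_lp_norm[OF assms(1), of x i] by (simp add: A_def)
    then show "x \<in> cbox (\<chi> i. -1) (\<chi> i. 1)"
      by (auto simp: mem_box_cart abs_less_iff less_imp_le minus_le_iff)
  qed
  then have "bounded A" by (rule bounded_subset[OF bounded_cbox])
  then show "emeasure lborel A < \<infinity>" by (rule emeasure_bounded_finite)
qed

lemma lp_uniform_measurable:
  "0 < p \<Longrightarrow> (\<lambda>x::real ^ 'n. x /\<^sub>R lp_norm p x) \<in> measurable borel borel"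
  using lp_norm_borel_measurable[where 'a='n] by measurable

lemma sets_lp_uniform [simp, measurable_cong]: "sets (lp_uniform p) = sets borel"
  by (simp add: lp_uniform_def)

lemma sets_lp_uniform_pos [simp, measurable_cong]: "sets (lp_uniform_pos p) = sets borel"
  by (simp add: lp_uniform_pos_def)

lemma prob_space_lp_uniform:
  assumes "0 < p"
  shows "prob_space (lp_uniform p :: (real ^ 'n) measure)"
  unfolding lp_uniform_def
  using emeasure_lp_ball[OF assms, where 'n='n] lp_uniform_measurable[OF assms, where 'n='n]
  by (intro prob_space.prob_space_distr prob_space_uniform_measure) auto

lemma AE_lp_uniform_iff:
  fixes P :: "real ^ 'n \<Rightarrow> bool"
  assumes "0 < p" and [measurable]: "Measurable.pred borel P"
  shows "(AE u in lp_uniform p. P u) \<longleftrightarrow>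
           (AE x in lborel. lp_norm p x < 1 \<longrightarrow> P (x /\<^sub>R lp_norm p x))"
proof -
  note [measurable] = lp_uniform_measurable[OF assms(1), where 'n='n]
  show ?thesis
    unfolding lp_uniform_def
    using emeasure_lp_ball[OF assms(1), where 'n='n]
    by (subst AE_distr_iff) (auto simp: AE_uniform_measure)
qed

lemma lp_uniform_nth_le_1:
  assumes "0 < p"
  shows "AE u in lp_uniform p :: (real ^ 'n) measure. \<bar>u $ i\<bar> \<le> 1"
proof -
  have "\<bar>(x /\<^sub>R lp_norm p x) $ i\<bar> \<le> 1" for x :: "real ^ 'n"
  \<comment> \<open>At norm 0 the convention \<open>inverse 0 = 0\<close> turns the normalised
    vector into 0.\<close>
  proof (cases "lp_norm p x = 0")
    case False
    then have "0 < lp_norm p x" by (simp add: lp_norm_def)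
    then show ?thesis
      using abs_nth_le_lp_norm[OF assms, of x i] by (simp add: abs_mult field_simps)
  qed simp
  then show ?thesis
    by (subst AE_lp_uniform_iff[OF assms]) auto
qed

text \<open>Otherwise almost all of the ball would lie in the hyperplane x_i = 0, a Lebesgue null
  set, although the ball has positive measure.\<close>

lemma lp_uniform_nth_not_AE_0:
  assumes "0 < p"
  shows "\<not> (AE u in lp_uniform p :: (real ^ 'n) measure. u $ i = 0)"
proof
  let ?A = "{x :: real ^ 'n. lp_norm p x < 1}"
  note A = emeasure_lp_ball[OF assms, where 'n='n]
  assume "AE u in lp_uniform p :: (real ^ 'n) measure. u $ i = 0"
  then have "AE x in lborel. lp_norm p x < 1 \<longrightarrow> (x /\<^sub>R lp_norm p x) $ i = 0"
    by (subst (asm) AE_lp_uniform_iff[OF assms]) auto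
  then have "AE x :: real ^ 'n in lborel. lp_norm p x < 1 \<longrightarrow> x $ i = 0"
  proof eventually_elim
    case (elim x)
    \<comment> \<open>If the norm is 0, the normalised vector carries no information, but then |x_i|
      \<le> \<open>lp_norm p x\<close> gives x_i = 0 directly.\<close>
    then show ?case using abs_nth_le_lp_norm[OF assms, of x i] by auto
  qed
  moreover have "AE x :: real ^ 'n in lborel. x $ i \<noteq> 0"
  proof (rule AE_I')
    have "negligible {x :: real ^ 'n. x $ i = 0}" by (rule negligible_standard_hyperplane_cart)
    moreover have "{x :: real ^ 'n. x $ i = 0} \<in> sets borel" by measurable
    ultimately show "{x :: real ^ 'n. x $ i = 0} \<in> null_sets lborel"
      by (simp add: negligible_iff_null_sets null_sets_completion_iff)
  qed auto
  ultimately have "AE x in lborel. x \<notin> ?A" by eventually_elim auto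
  then have "emeasure lborel ?A = 0"
    using emeasure_eq_0_AE[of "\<lambda>x. lp_norm p x < 1" lborel] by simp
  with A(1) show False ..
qed

section \<open>Passage to absolute values, and uniqueness of both kinds of copula\<close>

lemma componentwise_abs_measurable [measurable]:
  "componentwise_abs \<in> measurable borel (borel :: (real ^ 'n) measure)"
  unfolding componentwise_abs_def
  by (intro borel_measurable_continuous_onI continuous_intros)

lemma AE_lp_uniform_pos_iff:
  assumes "Measurable.pred borel P"
  shows "(AE u in lp_uniform_pos p. P u) \<longleftrightarrow> (AE u in lp_uniform p. P (componentwise_abs u))"
  unfolding lp_uniform_pos_def using assms by (subst AE_distr_iff) auto

text \<open>Any coordinate serves, hence the arbitrary index \<open>undefined\<close>. Both copulas
  share the uniform marginal there, and the bound 1 comes from the support [0,1]^n.\<close>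

lemma positive_lp_copula_unique:
  fixes C C' :: "(real ^ 'n) measure"
  assumes p: "0 < p" and C: "positive_lp_copula p C" and C': "positive_lp_copula p C'"
  shows "C = C'"
proof (rule radial_mixture_eq_of_marginal[of "lp_uniform_pos p" undefined 1])
  interpret prob_space "lp_uniform p :: (real ^ 'n) measure"
    by (rule prob_space_lp_uniform[OF p])
  show "prob_space (lp_uniform_pos p :: (real ^ 'n) measure)"
    unfolding lp_uniform_pos_def by (rule prob_space_distr) measurable
  show "AE u in lp_uniform_pos p :: (real ^ 'n) measure. \<bar>u $ undefined\<bar> \<le> 1"
    using lp_uniform_nth_le_1[OF p]
    by (subst AE_lp_uniform_pos_iff) (auto simp: componentwise_abs_def)
  show "\<not> (AE u in lp_uniform_pos p :: (real ^ 'n) measure. u $ undefined = 0)"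
    using lp_uniform_nth_not_AE_0[OF p]
    by (subst AE_lp_uniform_pos_iff) (auto simp: componentwise_abs_def)
  have "AE x in C. \<forall>i. x $ i \<in> {0..1}"
    using C by (simp add: positive_lp_copula_def copula_def)
  then show "AE x in C. \<bar>x $ undefined\<bar> \<le> 1"
    by eventually_elim auto
qed (use C C' in \<open>auto simp: positive_lp_copula_def lp_spherical_pos_def copula_def
       uniform_marginals_def\<close>)

text \<open>Rescaling by \<open>?f\<close> turns the uniform marginals into common marginals bounded
  by 1, so the rescaled laws agree; as \<open>?f\<close> is invertible, so do the copulas.\<close>

lemma circular_lp_copula_unique:
  fixes C C' :: "(real ^ 'n) measure"
  assumes p: "0 < p" and C: "circular_lp_copula p C" and C': "circular_lp_copula p C'"
  shows "C = C'"
proof -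
  let ?f = "\<lambda>x :: real ^ 'n. \<chi> i. 2 * x $ i - 1"
  let ?g = "\<lambda>x :: real ^ 'n. \<chi> i. (x $ i + 1) / 2"
  let ?U = "uniform_measure lborel {0 <..< 1 :: real}"
  define i :: 'n where "i = undefined"
  have [measurable_cong]: "sets C = sets borel" "sets C' = sets borel"
    using C C' by (auto simp: circular_lp_copula_def borel_prob_def)
  have [measurable]: "?f \<in> borel \<rightarrow>\<^sub>M borel" "?g \<in> borel \<rightarrow>\<^sub>M borel"
    by (auto intro!: borel_measurable_continuous_onI continuous_intros)
  have U: "distr C borel (\<lambda>x. x $ i) = ?U" "distr C' borel (\<lambda>x. x $ i) = ?U"
    using C C' by (auto simp: circular_lp_copula_def uniform_marginals_def)
  \<comment> \<open>Since \<open>?f\<close> acts coordinatewise, a marginal of the rescaled law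
    depends only on the same marginal of \<open>D\<close>.\<close>
  have marginal: "distr (distr D borel ?f) borel (\<lambda>x. x $ i)
      = distr (distr D borel (\<lambda>x. x $ i)) borel (\<lambda>y. 2 * y - 1)"
    if [measurable_cong]: "sets D = sets borel" for D :: "(real ^ 'n) measure"
    by (simp add: distr_distr comp_def)
  have "AE y in ?U. \<bar>2 * y - 1\<bar> \<le> 1"
    by (rule AE_uniform_measureI) auto
  then have bdd: "AE x in distr C borel ?f. \<bar>x $ i\<bar> \<le> 1"
    unfolding U(1)[symmetric] by (simp add: AE_distr_iff)
  have "distr C borel ?f = distr C' borel ?f"
  proof (rule radial_mixture_eq_of_marginal[OF prob_space_lp_uniform[OF p] _
        lp_uniform_nth_le_1[OF p] lp_uniform_nth_not_AE_0[OF p] _ _ _ bdd])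
    show "distr (distr C borel ?f) borel (\<lambda>x. x $ i)
        = distr (distr C' borel ?f) borel (\<lambda>x. x $ i)"
      by (simp add: marginal U \<open>sets C = sets borel\<close> \<open>sets C' = sets borel\<close>)
  qed (use C C' in \<open>auto simp: circular_lp_copula_def lp_spherical_def\<close>)
  \<comment> \<open>\<open>?g\<close> inverts \<open>?f\<close>, so \<open>D\<close> is recovered
    from its image.\<close>
  moreover have "D = distr (distr D borel ?f) borel ?g"
    if [measurable_cong]: "sets D = sets borel" for D :: "(real ^ 'n) measure"
    by (simp add: distr_distr comp_def distr_id2 that)
  ultimately show ?thesis
    using \<open>sets C = sets borel\<close> \<open>sets C' = sets borel\<close> by metis
qed

theorem theorem5:
  fixes p :: real
  assumes "1 \<le> p" and "2 \<le> CARD('n::finite)"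
  shows "(\<exists>\<^sub>\<le>\<^sub>1 C :: (real ^ 'n) measure. positive_lp_copula p C) \<and>
         (\<exists>\<^sub>\<le>\<^sub>1 C :: (real ^ 'n) measure. circular_lp_copula p C)"
proof -
  have "0 < p" using assms(1) by simp
  then show ?thesis
    by (blast intro: Uniq_I positive_lp_copula_unique circular_lp_copula_unique)
qed

end
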